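(* Let $F:\mathbb{R}^2\to\mathbb{R}$ be a scalar field satisfying the standing field assumption stated in the context, let $\rho>0$, $p_k\in\mathbb{R}^2$, $n\ge 1$, and let $\alpha_{k,1},\dots,\alpha_{k,n}\in\mathbb{R}$ be scan bearings. Suppose that the measurements are noiseless, i.e. $\mathsf{y}_{k,i}=F(p_k+\rho\varphi(\alpha_{k,i}))$ for $i=1,\dots,n$, and that the matrix $\Phi^1_{k,n}$ has full column rank. Then the first-harmonic least-squares gradient estimate $\hat g^{\,1}_{k,n}$ satisfies $$\hat g^{\,1}_{k,n}-\nabla F(p_k)=\rho B_{k,n}\begin{bmatrix}(F_{xx}(p_k)-F_{yy}(p_k))/4\\ F_{xy}(p_k)/2\end{bmatrix}+\varepsilon_{k,n},$$ where $$B_{k,n}=E\big((\Phi^1_{k,n})^\top\Phi^1_{k,n}\big)^{-1}(\Phi^1_{k,n})^\top\Phi^2_{k,n},\qquad \varepsilon_{k,n}=\frac1\rho E\big((\Phi^1_{k,n})^\top\Phi^1_{k,n}\big)^{-1}(\Phi^1_{k,n})^\top r_{k,n}.$$ Moreover, $$\|\varepsilon_{k,n}\|\leq\frac{M_3\rho^2\sqrt n}{6}\left\|E\big((\Phi^1_{k,n})^\top\Phi^1_{k,n}\big)^{-1}(\Phi^1_{k,n})^\top\right\|.$$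
   Context: Standing field assumption: $F\in C^3(\mathbb{R}^2)$ has a unique global minimizer $p^\star$, which is its only stationary point; for a given initial point $p_0$ the sublevel set $\{p:F(p)\le F(p_0)\}$ is compact; there are constants $G,L,M_3>0$ such that for all $p,\bar p\in\mathbb{R}^2$: $\|\nabla F(p)\|\le G$, $\|\nabla F(p)-\nabla F(\bar p)\|\le L\|p-\bar p\|$, $\|D^3F(p)\|\le M_3$ (operator norm of the trilinear form); and $F(p_0)-F(p^\star)\le\Delta_0$ for a constant $\Delta_0>0$. Coordinates $(x,y)$ are those of the episode-local frame (the frame in which scan bearings are measured), so $\alpha$ is directly the scan bearing; $F_x,F_y,F_{xx},F_{xy},F_{yy}$ and $\nabla F$ are partial derivatives and gradient in this frame. Write $\varphi(\alpha)=[\cos\alpha\ \ \sin\alpha]^\top$. The third-order Taylor remainder is $$r_p(\alpha)=F(p+\rho\varphi(\alpha))-F(p)-\rho\nabla F(p)^\top\varphi(\alpha)-\tfrac{\rho^2}{2}\varphi(\alpha)^\top\nabla^2F(p)\varphi(\alpha),$$ and $r_{k,n}=[r_{p_k}(\alpha_{k,1})\ \cdots\ r_{p_k}(\alpha_{k,n})]^\top\in\mathbb{R}^n$. $\Phi^1_{k,n}\in\mathbb{R}^{n\times3}$ has $i$th row $[1\ \ \cos\alpha_{k,i}\ \ \sin\alpha_{k,i}]$, and $\Phi^2_{k,n}\in\mathbb{R}^{n\times2}$ has $i$th row $[\cos2\alpha_{k,i}\ \ \sin2\alpha_{k,i}]$. $E=\begin{bmatrix}0&1&0\\0&0&1\end{bmatrix}$.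 With $\mathsf{Y}_{k,n}=[\mathsf{y}_{k,1}\ \cdots\ \mathsf{y}_{k,n}]^\top$, the first-harmonic ordinary least-squares estimate is $$\hat\zeta^{\,1}_{k,n}=\arg\min_{\zeta\in\mathbb{R}^3}\|\mathsf{Y}_{k,n}-\Phi^1_{k,n}\zeta\|^2=\big((\Phi^1_{k,n})^\top\Phi^1_{k,n}\big)^{-1}(\Phi^1_{k,n})^\top\mathsf{Y}_{k,n},$$ and the corresponding gradient estimate is $\hat g^{\,1}_{k,n}=\frac1\rho E\hat\zeta^{\,1}_{k,n}$. Vector norms are Euclidean and matrix norms are the induced (spectral) norms. *)

theory Defs
  imports "HOL-Analysis.Analysis"
begin

definition dir_deriv :: "'a::real_normed_vector \<Rightarrow> ('a \<Rightarrow> real) \<Rightarrow> 'a \<Rightarrow> real" where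
  "dir_deriv u f p = frechet_derivative f (at p) u"

definition partial :: "'m::finite \<Rightarrow> (real^'m \<Rightarrow> real) \<Rightarrow> real^'m \<Rightarrow> real" where
  "partial i f = dir_deriv (axis i 1) f"

primrec Ck :: "nat \<Rightarrow> (real^'m::finite \<Rightarrow> real) \<Rightarrow> bool" where
  "Ck 0 f \<longleftrightarrow> continuous_on UNIV f"
| "Ck (Suc k) f \<longleftrightarrow> (\<forall>p. f differentiable (at p)) \<and> (\<forall>i. Ck k (partial i f))"

definition grad :: "(real^'m::finite \<Rightarrow> real) \<Rightarrow> real^'m \<Rightarrow> real^'m" where
  "grad f p = (\<chi> i. partial i f p)"

definition hess :: "(real^'m::finite \<Rightarrow> real) \<Rightarrow> real^'m \<Rightarrow> real^'m^'m" where
  "hess f p = (\<chi> i j. partial j (partial i f) p)"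

definition D3 :: "('a::real_normed_vector \<Rightarrow> real) \<Rightarrow> 'a \<Rightarrow> 'a \<Rightarrow> 'a \<Rightarrow> 'a \<Rightarrow> real" where
  "D3 f p u v w = dir_deriv w (dir_deriv v (dir_deriv u f)) p"

text \<open>The supremum is that of a nonempty set, which is bounded above whenever the form is
  trilinear and the space is finite-dimensional, as for the third derivative of a \<open>C\<^sup>3\<close> function.\<close>

definition trilinear_norm :: "('a::euclidean_space \<Rightarrow> 'a \<Rightarrow> 'a \<Rightarrow> real) \<Rightarrow> real" where
  "trilinear_norm T =
     (SUP (u, v, w) \<in> sphere 0 1 \<times> sphere 0 1 \<times> sphere 0 1. \<bar>T u v w\<bar>)"

definition spectral_norm :: "real^'n::finite^'m::finite \<Rightarrow> real" where
  "spectral_norm A = onorm ((*v) A)"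

definition field_assumption ::
    "(real^2 \<Rightarrow> real) \<Rightarrow> real^2 \<Rightarrow> real^2 \<Rightarrow> real \<Rightarrow> real \<Rightarrow> real \<Rightarrow> real \<Rightarrow> bool" where
  "field_assumption F p\<^sub>0 pstar G L M3 \<Delta>\<^sub>0 \<longleftrightarrow>
     Ck 3 F \<and>
     (\<forall>q. q \<noteq> pstar \<longrightarrow> F pstar < F q) \<and>
     (\<forall>q. grad F q = 0 \<longleftrightarrow> q = pstar) \<and>
     compact {q. F q \<le> F p\<^sub>0} \<and>
     0 < G \<and> 0 < L \<and> 0 < M3 \<and> 0 < \<Delta>\<^sub>0 \<and>
     (\<forall>q. norm (grad F q) \<le> G) \<and>
     (\<forall>q q'. norm (grad F q - grad F q') \<le> L * norm (q - q')) \<and>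
     (\<forall>q. trilinear_norm (D3 F q) \<le> M3) \<and>
     F p\<^sub>0 - F pstar \<le> \<Delta>\<^sub>0"

definition phi :: "real \<Rightarrow> real^2" where
  "phi a = vector [cos a, sin a]"

definition remainder :: "(real^2 \<Rightarrow> real) \<Rightarrow> real \<Rightarrow> real^2 \<Rightarrow> real \<Rightarrow> real" where
  "remainder F \<rho> p a =
     F (p + \<rho> *\<^sub>R phi a) - F p - \<rho> * (grad F p \<bullet> phi a)
       - \<rho>\<^sup>2 / 2 * (phi a \<bullet> (hess F p *v phi a))"

definition remainder_vec ::
    "(real^2 \<Rightarrow> real) \<Rightarrow> real \<Rightarrow> real^2 \<Rightarrow> ('n::finite \<Rightarrow> real) \<Rightarrow> real^'n" where
  "remainder_vec F \<rho> p \<alpha> = (\<chi> i. remainder F \<rho> p (\<alpha> i))"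

definition Phi1 :: "('n::finite \<Rightarrow> real) \<Rightarrow> real^3^'n" where
  "Phi1 \<alpha> = (\<chi> i. vector [1, cos (\<alpha> i), sin (\<alpha> i)])"

definition Phi2 :: "('n::finite \<Rightarrow> real) \<Rightarrow> real^2^'n" where
  "Phi2 \<alpha> = (\<chi> i. vector [cos (2 * \<alpha> i), sin (2 * \<alpha> i)])"

definition Emat :: "real^3^2" where
  "Emat = vector [vector [0, 1, 0], vector [0, 0, 1]]"

definition least_squares :: "real^'m::finite^'n::finite \<Rightarrow> real^'n \<Rightarrow> real^'m" where
  "least_squares A Y = (ARG_MIN (\<lambda>z. (norm (Y - A *v z))\<^sup>2) z. True)"

definition g_hat :: "real \<Rightarrow> ('n::finite \<Rightarrow> real) \<Rightarrow> real^'n \<Rightarrow> real^2" where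
  "g_hat \<rho> \<alpha> Y = (1 / \<rho>) *\<^sub>R (Emat *v least_squares (Phi1 \<alpha>) Y)"

text \<open>\<^const>\<open>matrix_inv\<close> is meaningful here only if \<open>A\<close> has full column rank.\<close>

definition left_pinv :: "real^'m::finite^'n::finite \<Rightarrow> real^'n^'m" where
  "left_pinv A = matrix_inv (transpose A ** A) ** transpose A"

definition Bmat :: "('n::finite \<Rightarrow> real) \<Rightarrow> real^2^2" where
  "Bmat \<alpha> = Emat ** left_pinv (Phi1 \<alpha>) ** Phi2 \<alpha>"

definition eps_vec ::
    "(real^2 \<Rightarrow> real) \<Rightarrow> real \<Rightarrow> real^2 \<Rightarrow> ('n::finite \<Rightarrow> real) \<Rightarrow> real^2" where
  "eps_vec F \<rho> p \<alpha> =
     (1 / \<rho>) *\<^sub>R ((Emat ** left_pinv (Phi1 \<alpha>)) *v remainder_vec F \<rho> p \<alpha>)"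

end

theory Submission
  imports Defs
begin

text \<open>On the scan circle the second-order Taylor polynomial of \<open>F\<close> is a
  trigonometric polynomial in the bearing. The linear term gives a first harmonic with coefficients
  \<open>\<rho> *\<^sub>R grad F p\<close>. By the half-angle formulas the quadratic term splits
  into a constant and a second harmonic. Hence \<open>Y = Phi1 \<alpha> *v z + \<rho>\<^sup>2
  *\<^sub>R (Phi2 \<alpha> *v h) + r\<close> (\<open>measurement_vector\<close>), where
  \<open>z\<close> holds the intercept and the scaled gradient, and \<open>h\<close> the two
  second-harmonic coefficients.

  With full column rank, least squares is multiplication by \<open>left_pinv (Phi1 \<alpha>)\<close>
  (\<open>least_squares_eq_left_pinv\<close>), a left inverse of \<open>Phi1 \<alpha>\<close>. It
  returns \<open>z\<close> exactly, and \<open>Emat\<close> discards the intercept; what is left of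
  the error is the image of the second harmonic and of the remainder.

  The remainder bound is Lagrange's form of Taylor's theorem along the ray through a unit vector:
  each entry is at most \<open>M3 * \<rho> ^ 3 / 6\<close> (\<open>abs_remainder_le\<close>).
  Collecting the entries costs a factor \<open>sqrt n\<close>, and the estimate divides by
  \<open>\<rho>\<close>.

  Two analytic facts support this: mixed partials commute, so the off-diagonal Hessian entries merge
  into one coefficient, and the third derivative is bounded on unit vectors, so
  \<open>trilinear_norm\<close> really dominates its values.\<close>

section \<open>Iterated directional derivatives\<close>

lemma has_derivative_dir_deriv:
  assumes "f differentiable (at p)"
  shows "(f has_derivative (\<lambda>u. dir_deriv u f p)) (at p)"
  using assms unfolding dir_deriv_def by (simp add: frechet_derivative_works)

lemma dir_deriv_unique:
  assumes "(f has_derivative f') (at p)"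
  shows "dir_deriv u f p = f' u"
  using assms unfolding dir_deriv_def by (metis frechet_derivative_at)

text \<open>The chain rule on a line. It lets one-variable theorems be used, both for the symmetry
  of mixed partials and for the Taylor remainder.\<close>

lemma dir_deriv_along_line:
  fixes f :: "'a::real_normed_vector \<Rightarrow> real"
  assumes "f differentiable (at (p + t *\<^sub>R u))"
  shows "((\<lambda>s. f (p + s *\<^sub>R u)) has_real_derivative dir_deriv u f (p + t *\<^sub>R u)) (at t)"
proof -
  let ?q = "p + t *\<^sub>R u"
  note f = has_derivative_dir_deriv[OF assms]
  have "((\<lambda>s. f (p + s *\<^sub>R u)) has_derivative (\<lambda>s. dir_deriv (s *\<^sub>R u) f ?q)) (at t)"
    by (rule has_derivative_compose[where f = "\<lambda>s. p + s *\<^sub>R u", OF _ f])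
      (auto intro!: derivative_eq_intros)
  moreover have "dir_deriv (s *\<^sub>R u) f ?q = dir_deriv u f ?q * s" for s
    using linear_scale[OF has_derivative_linear[OF f], of s u] by simp
  ultimately show ?thesis
    by (simp add: has_field_derivative_def)
qed

lemma dir_deriv_linear_combination:
  fixes g :: "'i::finite \<Rightarrow> 'a::real_normed_vector \<Rightarrow> real"
  assumes "\<And>i. g i differentiable (at p)"
  shows "dir_deriv v (\<lambda>q. \<Sum>i\<in>UNIV. c i * g i q) p = (\<Sum>i\<in>UNIV. c i * dir_deriv v (g i) p)"
  by (rule dir_deriv_unique, rule has_derivative_sum, rule has_derivative_mult_right,
      rule has_derivative_dir_deriv[OF assms])

lemma dir_deriv_eq_sum_partial:
  fixes f :: "real^'m::finite \<Rightarrow> real"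
  assumes "f differentiable (at p)"
  shows "dir_deriv u f p = (\<Sum>i\<in>UNIV. u $ i * partial i f p)"
proof -
  note lin = has_derivative_linear[OF has_derivative_dir_deriv[OF assms]]
  have "dir_deriv u f p = dir_deriv (\<Sum>i\<in>UNIV. u $ i *\<^sub>R axis i 1) f p"
    by (simp add: basis_expansion flip: scalar_mult_eq_scaleR)
  also have "\<dots> = (\<Sum>i\<in>UNIV. u $ i * partial i f p)"
    unfolding partial_def
    using lin by (simp add: linear_sum[OF lin] linear_cmul[OF lin])
  finally show ?thesis .
qed

text \<open>The coordinates of \<open>u\<close> are constants, so the inner derivative is a fixed
  linear combination of partials and can be differentiated term by term. This links iterated
  directional derivatives to \<open>hess\<close>.\<close>

lemma dir_deriv2_eq_sum_partial:
  fixes f :: "real^'m::finite \<Rightarrow> real"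
  assumes "Ck (Suc (Suc k)) f"
  shows "dir_deriv v (dir_deriv u f) p =
    (\<Sum>i\<in>UNIV. u $ i * (\<Sum>j\<in>UNIV. v $ j * partial j (partial i f) p))"
proof -
  have d: "f differentiable (at q)" "partial i f differentiable (at q)" for q i
    using assms by auto
  have "dir_deriv u f = (\<lambda>q. \<Sum>i\<in>UNIV. u $ i * partial i f q)"
    by (simp add: fun_eq_iff dir_deriv_eq_sum_partial d)
  then show ?thesis
    by (simp add: dir_deriv_linear_combination d dir_deriv_eq_sum_partial)
qed

lemma differentiable_dir_deriv:
  fixes f :: "real^'m::finite \<Rightarrow> real"
  assumes "Ck (Suc (Suc k)) f"
  shows "dir_deriv u f differentiable (at q)"
proof -
  have "dir_deriv u f = (\<lambda>q. \<Sum>i\<in>UNIV. u $ i * partial i f q)"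
    using assms by (auto simp: fun_eq_iff dir_deriv_eq_sum_partial)
  then show ?thesis using assms by simp
qed

lemma D3_eq_sum_partial:
  fixes f :: "real^'m::finite \<Rightarrow> real"
  assumes "Ck 3 f"
  shows "D3 f p u v w =
    (\<Sum>i\<in>UNIV. u $ i * (\<Sum>j\<in>UNIV. v $ j * (\<Sum>k\<in>UNIV. w $ k * partial k (partial j (partial i f)) p)))"
proof -
  have C: "Ck (Suc (Suc 1)) f"
    using assms by (simp add: numeral_3_eq_3)
  have C2: "Ck (Suc (Suc 0)) (partial i f)" for i
    using C by simp
  have d: "partial i f differentiable (at q)" "partial j (partial i f) differentiable (at q)" for q i j
    using C by auto
  have "dir_deriv v (dir_deriv u f) = (\<lambda>q. \<Sum>i\<in>UNIV. u $ i * dir_deriv v (partial i f) q)"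
    by (simp add: fun_eq_iff dir_deriv2_eq_sum_partial[OF C] dir_deriv_eq_sum_partial d)
  then show ?thesis
    by (simp add: D3_def dir_deriv_linear_combination differentiable_dir_deriv[OF C2]
        dir_deriv2_eq_sum_partial[OF C2])
qed

lemma differentiable_dir_deriv2:
  fixes f :: "real^'m::finite \<Rightarrow> real"
  assumes "Ck (Suc (Suc (Suc k))) f"
  shows "dir_deriv v (dir_deriv u f) differentiable (at q)"
proof -
  have "dir_deriv v (dir_deriv u f) =
      (\<lambda>q. \<Sum>i\<in>UNIV. u $ i * (\<Sum>j\<in>UNIV. v $ j * partial j (partial i f) q))"
    using dir_deriv2_eq_sum_partial[OF assms] by (simp add: fun_eq_iff)
  then show ?thesis using assms by simp
qed

text \<open>A real supremum dominates its members only when the set is bounded above, hence the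
  first hypothesis; \<open>bdd_above_D3\<close> supplies it.\<close>

lemma abs_trilinear_le_trilinear_norm:
  assumes "bdd_above ((\<lambda>(u, v, w). \<bar>T u v w\<bar>) ` (sphere 0 1 \<times> sphere 0 1 \<times> sphere 0 1))"
    and "norm u = 1" "norm v = 1" "norm w = 1"
  shows "\<bar>T u v w\<bar> \<le> trilinear_norm T"
  unfolding trilinear_norm_def
  using cSUP_upper[OF _ assms(1), of "(u, v, w)"] assms by simp

text \<open>Coordinates of unit vectors have absolute value at most 1, so in the coordinate
  expansion the absolute third partials at \<open>p\<close> bound the form.\<close>

lemma bdd_above_D3:
  fixes f :: "real^'m::finite \<Rightarrow> real"
  assumes "Ck 3 f"
  shows "bdd_above ((\<lambda>(u, v, w). \<bar>D3 f p u v w\<bar>) ` (sphere 0 1 \<times> sphere 0 1 \<times> sphere 0 1))"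
proof (rule bdd_aboveI2, clarsimp)
  fix u v w :: "real^'m"
  assume n: "norm u = 1" "norm v = 1" "norm w = 1"
  have c: "\<bar>u $ i\<bar> \<le> 1" "\<bar>v $ i\<bar> \<le> 1" "\<bar>w $ i\<bar> \<le> 1" for i
    using component_le_norm_cart[of u i] component_le_norm_cart[of v i]
      component_le_norm_cart[of w i] n by auto
  have b: "\<bar>x * y\<bar> \<le> z" if "\<bar>x\<bar> \<le> 1" "\<bar>y\<bar> \<le> z" for x y z :: real
    using mult_mono[OF that] that by (simp add: abs_mult)
  show "\<bar>D3 f p u v w\<bar> \<le>
    (\<Sum>i\<in>UNIV. \<Sum>j\<in>UNIV. \<Sum>k\<in>UNIV. \<bar>partial k (partial j (partial i f)) p\<bar>)"
    unfolding D3_eq_sum_partial[OF assms]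
    by (intro sum_abs[THEN order_trans] sum_mono b c order_refl)
qed

section \<open>Symmetry of the second derivative\<close>

text \<open>Two mean value theorems: one in direction \<open>u\<close> for the increment of
  \<open>f\<close> under the shift \<open>h *\<^sub>R v\<close>, then one in direction
  \<open>v\<close> for the resulting increment of \<open>dir_deriv u f\<close>.\<close>

lemma second_difference_mvt:
  fixes f :: "'a::real_normed_vector \<Rightarrow> real"
  assumes f: "\<And>q. f differentiable (at q)"
    and fu: "\<And>q. dir_deriv u f differentiable (at q)"
    and h: "0 < h"
  obtains s t where "0 < s" "s < h" "0 < t" "t < h"
    "f (p + h *\<^sub>R u + h *\<^sub>R v) - f (p + h *\<^sub>R u) - f (p + h *\<^sub>R v) + f p =
       h\<^sup>2 * dir_deriv v (dir_deriv u f) (p + s *\<^sub>R u + t *\<^sub>R v)"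
proof -
  let ?g = "\<lambda>s. f (p + h *\<^sub>R v + s *\<^sub>R u) - f (p + s *\<^sub>R u)"
  let ?g' = "\<lambda>s. dir_deriv u f (p + h *\<^sub>R v + s *\<^sub>R u) - dir_deriv u f (p + s *\<^sub>R u)"
  have "DERIV ?g s :> ?g' s" for s
    by (intro DERIV_diff dir_deriv_along_line f)
  from MVT2[OF h this] obtain s where s: "0 < s" "s < h" "?g h - ?g 0 = (h - 0) * ?g' s"
    by blast
  have "DERIV (\<lambda>t. dir_deriv u f (p + s *\<^sub>R u + t *\<^sub>R v)) t
      :> dir_deriv v (dir_deriv u f) (p + s *\<^sub>R u + t *\<^sub>R v)" for t
    by (intro dir_deriv_along_line fu)
  from MVT2[OF h this] obtain t where t: "0 < t" "t < h"
    "dir_deriv u f (p + s *\<^sub>R u + h *\<^sub>R v) - dir_deriv u f (p + s *\<^sub>R u + 0 *\<^sub>R v)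
      = (h - 0) * dir_deriv v (dir_deriv u f) (p + s *\<^sub>R u + t *\<^sub>R v)"
    by blast
  show thesis
    using that[OF s(1,2) t(1,2)] s(3) t(3) by (simp add: algebra_simps power2_eq_square)
qed

text \<open>The second difference is symmetric in \<open>u\<close> and \<open>v\<close>, so both iterated derivatives take the same
  value at points arbitrarily close to \<open>p\<close>.\<close>

lemma dir_deriv_commute:
  fixes f :: "'a::real_normed_vector \<Rightarrow> real"
  assumes f: "\<And>q. f differentiable (at q)"
    and fu: "\<And>q. dir_deriv u f differentiable (at q)"
    and fv: "\<And>q. dir_deriv v f differentiable (at q)"
    and cuv: "isCont (dir_deriv v (dir_deriv u f)) p"
    and cvu: "isCont (dir_deriv u (dir_deriv v f)) p"
  shows "dir_deriv v (dir_deriv u f) p = dir_deriv u (dir_deriv v f) p"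
proof (rule ccontr)
  let ?A = "dir_deriv v (dir_deriv u f)" and ?B = "dir_deriv u (dir_deriv v f)"
  assume "?A p \<noteq> ?B p"
  then have e: "0 < dist (?A p) (?B p) / 2" by simp
  obtain d1 where d1: "0 < d1" "\<And>q. dist q p < d1 \<Longrightarrow> dist (?A q) (?A p) < dist (?A p) (?B p) / 2"
    using cuv[unfolded continuous_at_eps_delta, rule_format, OF e] by auto
  obtain d2 where d2: "0 < d2" "\<And>q. dist q p < d2 \<Longrightarrow> dist (?B q) (?B p) < dist (?A p) (?B p) / 2"
    using cvu[unfolded continuous_at_eps_delta, rule_format, OF e] by auto
  \<comment> \<open>Scaling by \<open>N\<close> keeps the whole parallelogram within
    \<open>min d1 d2\<close> of \<open>p\<close>; the summand 1 makes \<open>N\<close> positive and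
    the estimate strict.\<close>
  define N where "N = norm u + norm v + 1"
  define h where "h = min d1 d2 / N"
  have N: "0 < N" unfolding N_def using norm_ge_zero[of u] norm_ge_zero[of v] by linarith
  have h: "0 < h" using N d1(1) d2(1) by (simp add: h_def)
  have small: "norm (s *\<^sub>R u + t *\<^sub>R v) < min d1 d2" if "0 < s" "s < h" "0 < t" "t < h" for s t
  proof -
    have "norm (s *\<^sub>R u + t *\<^sub>R v) \<le> s * norm u + t * norm v"
      using norm_triangle_ineq[of "s *\<^sub>R u" "t *\<^sub>R v"] that by simp
    also have "\<dots> \<le> h * norm u + h * norm v"
      using that by (intro add_mono mult_right_mono) auto
    also have "\<dots> < h * N" using h by (simp add: N_def algebra_simps)
    also have "\<dots> = min d1 d2" using N by (simp add: h_def)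
    finally show ?thesis .
  qed
  obtain s t where st: "0 < s" "s < h" "0 < t" "t < h"
    "f (p + h *\<^sub>R u + h *\<^sub>R v) - f (p + h *\<^sub>R u) - f (p + h *\<^sub>R v) + f p =
       h\<^sup>2 * ?A (p + s *\<^sub>R u + t *\<^sub>R v)"
    by (rule second_difference_mvt[OF f fu h])
  obtain t' s' where st': "0 < t'" "t' < h" "0 < s'" "s' < h"
    "f (p + h *\<^sub>R v + h *\<^sub>R u) - f (p + h *\<^sub>R v) - f (p + h *\<^sub>R u) + f p =
       h\<^sup>2 * ?B (p + t' *\<^sub>R v + s' *\<^sub>R u)"
    by (rule second_difference_mvt[OF f fv h])
  \<comment> \<open>Swapping \<open>u\<close> and \<open>v\<close> leaves the second difference
    unchanged.\<close>
  have "h\<^sup>2 * ?A (p + s *\<^sub>R u + t *\<^sub>R v) = h\<^sup>2 * ?B (p + t' *\<^sub>R v + s' *\<^sub>R u)"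
    unfolding st(5)[symmetric] st'(5)[symmetric] by (simp add: algebra_simps)
  then have eq: "?A (p + s *\<^sub>R u + t *\<^sub>R v) = ?B (p + t' *\<^sub>R v + s' *\<^sub>R u)"
    using h by simp
  have "dist (p + s *\<^sub>R u + t *\<^sub>R v) p < d1"
    using small[OF st(1-4)] by (simp add: dist_norm add.assoc)
  from d1(2)[OF this] have "dist (?A (p + s *\<^sub>R u + t *\<^sub>R v)) (?A p) < dist (?A p) (?B p) / 2" .
  moreover have "dist (p + t' *\<^sub>R v + s' *\<^sub>R u) p < d2"
    using small[OF st'(3,4,1,2)] by (simp add: dist_norm add.assoc add.commute[of "t' *\<^sub>R v"])
  from d2(2)[OF this] have "dist (?B (p + t' *\<^sub>R v + s' *\<^sub>R u)) (?B p) < dist (?A p) (?B p) / 2" .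
  \<comment> \<open>One common value lies within half of \<open>dist (?A p) (?B p)\<close> of both
    \<open>?A p\<close> and \<open>?B p\<close>, which is impossible.\<close>
  ultimately show False
    using dist_triangle_half_r[of "?A (p + s *\<^sub>R u + t *\<^sub>R v)" "?A p" "dist (?A p) (?B p)" "?B p"]
    by (simp add: eq dist_commute)
qed

lemma partial_commute:
  fixes f :: "real^'m::finite \<Rightarrow> real"
  assumes "Ck (Suc (Suc k)) f" "isCont (partial j (partial i f)) p" "isCont (partial i (partial j f)) p"
  shows "partial j (partial i f) p = partial i (partial j f) p"
proof -
  have "partial i f differentiable (at q)" "partial j f differentiable (at q)"
    "f differentiable (at q)" for q
    using assms(1) by auto
  then show ?thesis
    using dir_deriv_commute[of f "axis i 1" "axis j 1" p] assms(2,3)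
    by (simp add: partial_def[abs_def])
qed

section \<open>The Taylor remainder\<close>

lemma norm_phi [simp]: "norm (phi a) = 1"
  by (simp add: phi_def norm_eq_1 inner_vec_def sum_2 power2_eq_square[symmetric])

lemma grad_inner_eq_dir_deriv:
  assumes "f differentiable (at p)"
  shows "grad f p \<bullet> u = dir_deriv u f p"
  by (simp add: grad_def inner_vec_def dir_deriv_eq_sum_partial[OF assms] mult.commute)

lemma hess_quadratic_form_eq_dir_deriv:
  assumes "Ck (Suc (Suc k)) f"
  shows "u \<bullet> (hess f p *v u) = dir_deriv u (dir_deriv u f) p"
  by (simp add: hess_def inner_vec_def matrix_vector_mult_def dir_deriv2_eq_sum_partial[OF assms]
      mult.commute)

text \<open>Taylor's theorem for \<open>F\<close> restricted to the ray in direction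
  \<open>phi a\<close>. The terms of order 0, 1, 2 are the ones subtracted in
  \<open>remainder\<close>, so only the Lagrange term with \<open>fact 3 = 6\<close>
  survives.\<close>

lemma abs_remainder_le:
  assumes C: "Ck 3 F" and M: "\<And>q. trilinear_norm (D3 F q) \<le> M3" and \<rho>: "0 < \<rho>"
  shows "\<bar>remainder F \<rho> p a\<bar> \<le> M3 * \<rho> ^ 3 / 6"
proof -
  let ?u = "phi a"
  have C': "Ck (Suc (Suc (Suc 0))) F"
    using C by (simp add: numeral_3_eq_3)
  \<comment> \<open>The \<open>m\<close>-th derivative of \<open>F\<close> along the ray, in the
    form that \<open>Maclaurin\<close> expects.\<close>
  define diff where "diff m t = (dir_deriv ?u ^^ m) F (p + t *\<^sub>R ?u)" for m t
  have "DERIV (diff m) t :> diff (Suc m) t" if "m < 3" for m t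
  proof -
    have "(dir_deriv ?u ^^ m) F differentiable (at q)" for q
      using that C' differentiable_dir_deriv[OF C'] differentiable_dir_deriv2[OF C']
      by (auto simp: less_Suc_eq numeral_3_eq_3)
    from dir_deriv_along_line[OF this] show ?thesis
      by (simp add: diff_def[abs_def])
  qed
  then obtain t where t: "diff 0 \<rho> = (\<Sum>m<3. diff m 0 / fact m * \<rho> ^ m) + diff 3 t / fact 3 * \<rho> ^ 3"
    using Maclaurin[of \<rho> 3 diff "diff 0"] \<rho> by auto
  have rem: "remainder F \<rho> p a = D3 F (p + t *\<^sub>R ?u) ?u ?u ?u / 6 * \<rho> ^ 3"
    using t grad_inner_eq_dir_deriv[of F p ?u] C'
    by (simp add: remainder_def hess_quadratic_form_eq_dir_deriv[OF C'] diff_def D3_def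
        numeral_3_eq_3 power2_eq_square fact_numeral)
  have "\<bar>D3 F (p + t *\<^sub>R ?u) ?u ?u ?u\<bar> \<le> M3"
    by (rule order_trans[OF abs_trilinear_le_trilinear_norm[OF bdd_above_D3[OF C]] M]) simp_all
  then have "\<bar>D3 F (p + t *\<^sub>R ?u) ?u ?u ?u\<bar> / 6 * \<rho> ^ 3 \<le> M3 / 6 * \<rho> ^ 3"
    using \<rho> by (intro mult_right_mono divide_right_mono) auto
  also have "\<bar>D3 F (p + t *\<^sub>R ?u) ?u ?u ?u\<bar> / 6 * \<rho> ^ 3 = \<bar>remainder F \<rho> p a\<bar>"
    using \<rho> by (simp add: rem abs_mult)
  finally show ?thesis by simp
qed

section \<open>Least squares\<close>

text \<open>The Gram matrix has the same kernel as \<open>A\<close>, because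
  \<open>x \<bullet> (transpose A ** A *v x)\<close> is the squared norm of \<open>A *v x\<close>;
  full column rank makes that kernel trivial.\<close>

lemma matrix_inv_gram:
  fixes A :: "real^'m::finite^'n::finite"
  assumes "rank A = CARD('m)"
  shows "matrix_inv (transpose A ** A) ** (transpose A ** A) = mat 1"
    and "(transpose A ** A) ** matrix_inv (transpose A ** A) = mat 1"
proof -
  have inj: "inj ((*v) A)"
    using assms by (simp add: full_rank_injective)
  have "x = 0" if "(transpose A ** A) *v x = 0" for x
  proof -
    have "(A *v x) \<bullet> (A *v x) = x \<bullet> ((transpose A ** A) *v x)"
      by (metis dot_lmul_matrix inner_commute matrix_vector_mul_assoc transpose_matrix_vector)
    then have "A *v x = A *v 0" using that by simp
    then show ?thesis using inj by (simp only: inj_eq)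
  qed
  then have "invertible (transpose A ** A)"
    using invertible_left_inverse matrix_left_invertible_ker by blast
  then have "(transpose A ** A) ** matrix_inv (transpose A ** A) = mat 1 \<and>
      matrix_inv (transpose A ** A) ** (transpose A ** A) = mat 1"
    unfolding matrix_inv_def invertible_def by (rule someI_ex)
  then show "matrix_inv (transpose A ** A) ** (transpose A ** A) = mat 1"
    and "(transpose A ** A) ** matrix_inv (transpose A ** A) = mat 1"
    by blast+
qed

lemma left_pinv_mult:
  fixes A :: "real^'m::finite^'n::finite"
  assumes "rank A = CARD('m)"
  shows "left_pinv A ** A = mat 1"
  using matrix_inv_gram(1)[OF assms] by (simp add: left_pinv_def matrix_mul_assoc)

text \<open>By the normal equations the residual at \<open>?z\<close> is orthogonal to the range of
  \<open>A\<close>. Pythagoras then makes \<open>?z\<close> a minimizer, and injectivity of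
  \<open>A\<close> makes it the only one.\<close>

lemma least_squares_eq_left_pinv:
  fixes A :: "real^'m::finite^'n::finite"
  assumes "rank A = CARD('m)"
  shows "least_squares A Y = left_pinv A *v Y"
proof -
  let ?z = "left_pinv A *v Y"
  let ?f = "\<lambda>z. (norm (Y - A *v z))\<^sup>2"
  have "transpose A *v (Y - A *v ?z) = 0"
    using matrix_inv_gram(2)[OF assms]
    by (simp add: left_pinv_def matrix_vector_mult_diff_distrib matrix_vector_mul_assoc
        matrix_mul_assoc del: transpose_matrix_vector)
  then have orth: "(Y - A *v ?z) \<bullet> (A *v x) = 0" for x
    by (metis dot_lmul_matrix inner_zero_left transpose_matrix_vector)
  have pyth: "?f z = ?f ?z + (norm (A *v (?z - z)))\<^sup>2" for z
  proof -
    have "Y - A *v z = (Y - A *v ?z) + A *v (?z - z)"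
      by (simp add: matrix_vector_mult_diff_distrib)
    then show ?thesis
      using orth[of "?z - z"] by (simp only: power2_norm_eq_inner) (simp add: inner_add inner_commute)
  qed
  have le: "?f ?z \<le> ?f z" for z
    using pyth[of z] by simp
  \<comment> \<open>\<open>ARG_MIN\<close> is a choice operator; the witness \<open>?z\<close> shows
    that a minimizer exists, so the chosen value is one.\<close>
  have "is_arg_min ?f (\<lambda>z. True) (least_squares A Y)"
    unfolding least_squares_def arg_min_def
    by (rule someI[of _ ?z]) (simp add: is_arg_min_linorder le)
  then have "?f (least_squares A Y) \<le> ?f ?z"
    by (simp add: is_arg_min_linorder)
  \<comment> \<open>Equal minimal values force the extra square in \<open>pyth\<close> to
    vanish.\<close>
  then have "A *v (?z - least_squares A Y) = A *v 0"
    using pyth[of "least_squares A Y"] by simp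
  moreover have "inj ((*v) A)"
    using assms by (simp add: full_rank_injective)
  ultimately have "?z - least_squares A Y = 0"
    by (simp only: inj_eq)
  then show ?thesis by simp
qed

lemma norm_matrix_vector_mult_le:
  "norm (A *v x) \<le> spectral_norm A * norm x"
  unfolding spectral_norm_def by (rule onorm) (rule matrix_vector_mul_bounded_linear)

lemma norm_vec_le_sqrt_card:
  fixes x :: "real^'n::finite"
  assumes "\<And>i. \<bar>x $ i\<bar> \<le> c"
  shows "norm x \<le> sqrt (real CARD('n)) * c"
proof -
  have "0 \<le> c" using order_trans[OF abs_ge_zero assms] .
  have "(norm x)\<^sup>2 = (\<Sum>i\<in>UNIV. \<bar>x $ i\<bar>\<^sup>2)"
    by (simp add: power2_norm_eq_inner inner_vec_def flip: power2_eq_square)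
  also have "\<dots> \<le> (\<Sum>i\<in>(UNIV :: 'n set). c\<^sup>2)"
    by (intro sum_mono power_mono assms abs_ge_zero)
  also have "\<dots> = (sqrt (real CARD('n)) * c)\<^sup>2"
    by (simp add: power_mult_distrib)
  finally show ?thesis
    by (rule power2_le_imp_le) (simp add: \<open>0 \<le> c\<close>)
qed

section \<open>The gradient estimate\<close>

text \<open>The half-angle formulas split the quadratic Taylor term into a constant, absorbed in the
  intercept, and a second harmonic, which is what biases the estimate.\<close>

lemma measurement_harmonics:
  assumes C: "Ck 3 F"
  shows "F (p + \<rho> *\<^sub>R phi a) =
    (F p + \<rho>\<^sup>2 / 4 * (partial 1 (partial 1 F) p + partial 2 (partial 2 F) p))
    + \<rho> * (partial 1 F p * cos a + partial 2 F p * sin a)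
    + \<rho>\<^sup>2 * ((partial 1 (partial 1 F) p - partial 2 (partial 2 F) p) / 4 * cos (2 * a)
             + partial 2 (partial 1 F) p / 2 * sin (2 * a))
    + remainder F \<rho> p a"
proof -
  have C': "Ck (Suc (Suc (Suc 0))) F"
    using C by (simp add: numeral_3_eq_3)
  \<comment> \<open>Under \<open>Ck 3\<close> the second partials are differentiable, hence
    continuous, as symmetry of the Hessian requires.\<close>
  have "isCont (partial j (partial i F)) q" for i j q
    using C' by (intro differentiable_imp_continuous_within) simp
  then have sym: "partial 1 (partial 2 F) p = partial 2 (partial 1 F) p"
    by (intro partial_commute[OF C'])
  have half: "cos a * cos a = (1 + cos (2 * a)) / 2" "sin a * sin a = (1 - cos (2 * a)) / 2"
    "cos a * sin a = sin (2 * a) / 2"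
    using sin_squared_eq[of a] by (simp_all add: cos_double_cos sin_double power2_eq_square)
  have quad: "phi a \<bullet> (hess F p *v phi a) = partial 1 (partial 1 F) p * (cos a * cos a)
      + 2 * partial 2 (partial 1 F) p * (cos a * sin a) + partial 2 (partial 2 F) p * (sin a * sin a)"
    by (simp add: hess_def phi_def inner_vec_def matrix_vector_mult_def sum_2 sym algebra_simps)
  have lin: "grad F p \<bullet> phi a = partial 1 F p * cos a + partial 2 F p * sin a"
    by (simp add: grad_def phi_def inner_vec_def sum_2)
  show ?thesis
    unfolding remainder_def quad lin half by (simp add: field_simps)
qed

lemma measurement_vector:
  assumes "Ck 3 F" and "\<forall>i. Y $ i = F (p + \<rho> *\<^sub>R phi (\<alpha> i))"
  shows "Y = Phi1 \<alpha> *v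
      vector [F p + \<rho>\<^sup>2 / 4 * (partial 1 (partial 1 F) p + partial 2 (partial 2 F) p),
              \<rho> * partial 1 F p, \<rho> * partial 2 F p]
    + \<rho>\<^sup>2 *\<^sub>R (Phi2 \<alpha> *v
        vector [(partial 1 (partial 1 F) p - partial 2 (partial 2 F) p) / 4,
                partial 2 (partial 1 F) p / 2])
    + remainder_vec F \<rho> p \<alpha>"
  using assms(2) measurement_harmonics[OF assms(1)]
  by (simp add: vec_eq_iff Phi1_def Phi2_def remainder_vec_def matrix_vector_mult_def sum_2 sum_3
      algebra_simps)

lemma Emat_mult_vector: "Emat *v z = vector [z $ 2, z $ 3]"
  by (simp add: Emat_def vec_eq_iff forall_2 matrix_vector_mult_def sum_3)

theorem proposition1:
  fixes F :: "real^2 \<Rightarrow> real"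
    and p\<^sub>0 pstar p :: "real^2"
    and G L M3 \<Delta>\<^sub>0 \<rho> :: real
    and \<alpha> :: "'n::finite \<Rightarrow> real"
    and Y :: "real^'n"
  assumes field: "field_assumption F p\<^sub>0 pstar G L M3 \<Delta>\<^sub>0"
    and rho_pos: "\<rho> > 0"
    and noiseless: "\<forall>i. Y $ i = F (p + \<rho> *\<^sub>R phi (\<alpha> i))"
    and full_column_rank: "rank (Phi1 \<alpha>) = 3"
  shows "g_hat \<rho> \<alpha> Y - grad F p =
           \<rho> *\<^sub>R (Bmat \<alpha> *v vector [(partial 1 (partial 1 F) p - partial 2 (partial 2 F) p) / 4,
                                  partial 2 (partial 1 F) p / 2])
           + eps_vec F \<rho> p \<alpha>
         \<and> norm (eps_vec F \<rho> p \<alpha>)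
           \<le> M3 * \<rho>\<^sup>2 * sqrt (real CARD('n)) / 6
             * spectral_norm (Emat ** left_pinv (Phi1 \<alpha>))"
proof (intro conjI)
  have C: "Ck 3 F" and M: "\<And>q. trilinear_norm (D3 F q) \<le> M3"
    using field by (auto simp: field_assumption_def)
  have rank: "rank (Phi1 \<alpha>) = CARD(3)"
    using full_column_rank by simp
  let ?P = "left_pinv (Phi1 \<alpha>)" and ?r = "remainder_vec F \<rho> p \<alpha>"
  let ?z = "vector [F p + \<rho>\<^sup>2 / 4 * (partial 1 (partial 1 F) p + partial 2 (partial 2 F) p),
              \<rho> * partial 1 F p, \<rho> * partial 2 F p] :: real^3"
  let ?h = "vector [(partial 1 (partial 1 F) p - partial 2 (partial 2 F) p) / 4,
              partial 2 (partial 1 F) p / 2] :: real^2"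
  \<comment> \<open>Whatever lies in the range of \<open>Phi1 \<alpha>\<close> is recovered without
    error, including the constant produced by the quadratic term.\<close>
  have "?P *v (Phi1 \<alpha> *v ?z) = ?z"
    by (simp add: matrix_vector_mul_assoc left_pinv_mult[OF rank])
  then have "least_squares (Phi1 \<alpha>) Y = ?z + \<rho>\<^sup>2 *\<^sub>R (?P *v (Phi2 \<alpha> *v ?h)) + ?P *v ?r"
    unfolding least_squares_eq_left_pinv[OF rank]
    by (subst measurement_vector[OF C noiseless])
      (simp add: matrix_vector_right_distrib matrix_vector_mult_scaleR)
  \<comment> \<open>\<open>Emat\<close> removes the intercept, and with it the Laplacian term,
    leaving exactly the gradient.\<close>
  moreover have "(1 / \<rho>) *\<^sub>R (Emat *v ?z) = grad F p"
    using rho_pos by (simp add: Emat_mult_vector vec_eq_iff forall_2 grad_def)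
  ultimately show "g_hat \<rho> \<alpha> Y - grad F p = \<rho> *\<^sub>R (Bmat \<alpha> *v ?h) + eps_vec F \<rho> p \<alpha>"
    using rho_pos
    by (simp add: g_hat_def Bmat_def eps_vec_def matrix_vector_right_distrib
        matrix_vector_mult_scaleR scaleR_right_distrib power2_eq_square
        flip: matrix_vector_mul_assoc)
  have r: "norm ?r \<le> sqrt (real CARD('n)) * (M3 * \<rho> ^ 3 / 6)"
    by (rule norm_vec_le_sqrt_card)
      (simp only: remainder_vec_def vec_lambda_beta abs_remainder_le[OF C M rho_pos])
  have "0 \<le> spectral_norm (Emat ** ?P)"
    unfolding spectral_norm_def by (intro onorm_pos_le matrix_vector_mul_bounded_linear)
  then have "norm ((Emat ** ?P) *v ?r)
      \<le> spectral_norm (Emat ** ?P) * (sqrt (real CARD('n)) * (M3 * \<rho> ^ 3 / 6))"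
    using norm_matrix_vector_mult_le[of "Emat ** ?P" ?r] mult_left_mono[OF r] order_trans by blast
  \<comment> \<open>The prefactor of \<open>eps_vec\<close> lowers the cubic power of
    \<open>\<rho>\<close> to the square.\<close>
  then have "1 / \<rho> * norm ((Emat ** ?P) *v ?r)
      \<le> 1 / \<rho> * (spectral_norm (Emat ** ?P) * (sqrt (real CARD('n)) * (M3 * \<rho> ^ 3 / 6)))"
    using rho_pos by (intro mult_left_mono) auto
  then have "norm (eps_vec F \<rho> p \<alpha>)
      \<le> 1 / \<rho> * (spectral_norm (Emat ** ?P) * (sqrt (real CARD('n)) * (M3 * \<rho> ^ 3 / 6)))"
    using rho_pos by (simp only: eps_vec_def norm_scaleR) simp
  also have "\<dots> = M3 * \<rho>\<^sup>2 * sqrt (real CARD('n)) / 6 * spectral_norm (Emat ** ?P)"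
    using rho_pos by (simp add: power2_eq_square power3_eq_cube)
  finally show "norm (eps_vec F \<rho> p \<alpha>)
      \<le> M3 * \<rho>\<^sup>2 * sqrt (real CARD('n)) / 6 * spectral_norm (Emat ** ?P)" .
qed

end
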